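(* Let $\mathcal A$ and $\mathfrak A$ be Banach algebras such that $\mathcal A$ is a Banach $\mathfrak A$-bimodule with compatible actions. Let $E=\{(\varphi,\widetilde\varphi):\varphi\in\sigma(\mathcal A)\}$ and $F=\{(0,\psi):\psi\in\sigma(\mathfrak A)\}$ (so $E=\emptyset$ if $\sigma(\mathcal A)=\emptyset$, and $F=\emptyset$ if $\sigma(\mathfrak A)=\emptyset$). Then $E$ and $F$ are disjoint and $\sigma(\mathcal A\rtimes\mathfrak A)=E\cup F$.
   Context: The actions of $\mathfrak A$ on $\mathcal A$ are compatible if for all $a,b\in\mathcal A$ and $\beta\in\mathfrak A$: $\beta\cdot(ab)=(\beta\cdot a)b$, $(ab)\cdot\beta=a(b\cdot\beta)$, $a(\beta\cdot b)=(a\cdot\beta)b$. The amalgamated duplication $\mathcal A\rtimes\mathfrak A$ is $\mathcal A\times\mathfrak A$ with product $(a,\beta)(b,\gamma)=(ab+a\cdot\gamma+\beta\cdot b,\ \beta\gamma)$ and norm $\|(a,\beta)\|=\|a\|+\|\beta\|$. For a Banach algebra $\mathcal C$, $\sigma(\mathcal C)$ is the set of all non-zero multiplicative linear functionals on $\mathcal C$. The dual of $\mathcal A\rtimes\mathfrak A$ is identified with the product of the duals of $\mathcal A$ and $\mathfrak A$ via $\langle(\varphi,\psi),(a,\beta)\rangle=\varphi(a)+\psi(\beta)$. For $\varphi\in\sigma(\mathcal A)$, $\widetilde\varphi$ denotes the unique element of $\sigma(\mathfrak A)\cup\{0\}$ such that $\varphi(a\cdot\beta)=\varphi(\beta\cdot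 a)=\varphi(a)\widetilde\varphi(\beta)$ for all $a\in\mathcal A$, $\beta\in\mathfrak A$ (such an element exists and is unique). *)

theory Defs
  imports "HOL-Analysis.Analysis"
begin

text \<open>
  The product of the amalgamated duplication depends on the module actions and its norm is the sum
  norm, so it cannot be a type class instance on the product type. Algebras are therefore records
  of operations over an additive group type (the carrier is the whole type); Banach algebras are
  complex, and not assumed to be unital.
\<close>

record 'c normed_alg =
  smul :: "complex \<Rightarrow> 'c \<Rightarrow> 'c"
  mul :: "'c \<Rightarrow> 'c \<Rightarrow> 'c"
  nrm :: "'c \<Rightarrow> real"

locale banach_algebra =
  fixes C :: "'c::ab_group_add normed_alg"
  assumes vector_space: "vector_space (smul C)"
    and nrm_eq_0_iff: "nrm C x = 0 \<longleftrightarrow> x = 0"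
    and nrm_triangle: "nrm C (x + y) \<le> nrm C x + nrm C y"
    and nrm_smul: "nrm C (smul C c x) = cmod c * nrm C x"
    and complete: "Metric_space.mcomplete UNIV (\<lambda>x y. nrm C (x - y))"
    and linear_mul_right: "Vector_Spaces.linear (smul C) (smul C) (\<lambda>y. mul C x y)"
    and linear_mul_left: "Vector_Spaces.linear (smul C) (smul C) (\<lambda>x. mul C x y)"
    and mul_assoc: "mul C (mul C x y) z = mul C x (mul C y z)"
    and nrm_mul: "nrm C (mul C x y) \<le> nrm C x * nrm C y"

text \<open>
  Here \<open>l \<beta> a\<close> is the left action \<open>\<beta> \<cdot> a\<close> and \<open>r a \<beta>\<close> is the right action \<open>a \<cdot> \<beta>\<close>. The actions are
  only required to be bounded; the bound need not be \<open>1\<close>.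
\<close>

locale banach_bimodule = A: banach_algebra A + B: banach_algebra B
  for A :: "'a::ab_group_add normed_alg" and B :: "'b::ab_group_add normed_alg" +
  fixes l :: "'b \<Rightarrow> 'a \<Rightarrow> 'a" and r :: "'a \<Rightarrow> 'b \<Rightarrow> 'a"
  assumes linear_l_right: "Vector_Spaces.linear (smul A) (smul A) (\<lambda>a. l \<beta> a)"
    and linear_l_left: "Vector_Spaces.linear (smul B) (smul A) (\<lambda>\<beta>. l \<beta> a)"
    and linear_r_right: "Vector_Spaces.linear (smul B) (smul A) (\<lambda>\<beta>. r a \<beta>)"
    and linear_r_left: "Vector_Spaces.linear (smul A) (smul A) (\<lambda>a. r a \<beta>)"
    and l_mul: "l (mul B \<beta> \<gamma>) a = l \<beta> (l \<gamma> a)"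
    and r_mul: "r a (mul B \<beta> \<gamma>) = r (r a \<beta>) \<gamma>"
    and l_r: "r (l \<beta> a) \<gamma> = l \<beta> (r a \<gamma>)"
    and bounded_l: "\<exists>K. \<forall>\<beta> a. nrm A (l \<beta> a) \<le> K * nrm B \<beta> * nrm A a"
    and bounded_r: "\<exists>K. \<forall>a \<beta>. nrm A (r a \<beta>) \<le> K * nrm A a * nrm B \<beta>"

definition compatible_actions ::
  "'a normed_alg \<Rightarrow> ('b \<Rightarrow> 'a \<Rightarrow> 'a) \<Rightarrow> ('a \<Rightarrow> 'b \<Rightarrow> 'a) \<Rightarrow> bool" where
  "compatible_actions A l r \<longleftrightarrow>
    (\<forall>a b \<beta>. l \<beta> (mul A a b) = mul A (l \<beta> a) b \<and>
             r (mul A a b) \<beta> = mul A a (r b \<beta>) \<and>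
             mul A a (l \<beta> b) = mul A (r a \<beta>) b)"

definition amalgamated_duplication ::
  "'a::ab_group_add normed_alg \<Rightarrow> 'b normed_alg \<Rightarrow> ('b \<Rightarrow> 'a \<Rightarrow> 'a) \<Rightarrow> ('a \<Rightarrow> 'b \<Rightarrow> 'a) \<Rightarrow>
    ('a \<times> 'b) normed_alg" where
  "amalgamated_duplication A B l r =
    \<lparr>smul = (\<lambda>c (a, \<beta>). (smul A c a, smul B c \<beta>)),
     mul = (\<lambda>(a, \<beta>) (b, \<gamma>). (mul A a b + r a \<gamma> + l \<beta> b, mul B \<beta> \<gamma>)),
     nrm = (\<lambda>(a, \<beta>). nrm A a + nrm B \<beta>)\<rparr>"

context banach_algebra begin

lemma smul_zero: "smul C 0 x = 0" "smul C (-1) x = - x" "smul C c 0 = 0"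
proof -
  interpret vector_space "smul C" by (rule vector_space)
  show "smul C 0 x = 0" "smul C (-1) x = - x" "smul C c 0 = 0" by auto
qed

lemma nrm_minus: "nrm C (- x) = nrm C x" using nrm_smul[of "-1" x] by (simp add: smul_zero)

lemma nrm_nonneg: "0 \<le> nrm C x"
  using nrm_triangle[of x "-x"] nrm_minus[of x] nrm_eq_0_iff[of 0] by simp

lemma Metric_space_nrm: "Metric_space UNIV (\<lambda>x y. nrm C (x - y))"
proof
  fix x y z
  show "0 \<le> nrm C (x - y)" by (rule nrm_nonneg)
  show "nrm C (x - y) = nrm C (y - x)" using nrm_minus[of "x - y"] by simp
  show "nrm C (x - y) = 0 \<longleftrightarrow> x = y" by (simp add: nrm_eq_0_iff)
  show "nrm C (x - z) \<le> nrm C (x - y) + nrm C (y - z)" using nrm_triangle[of "x - y" "y - z"] by simp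
qed

end

text \<open>
  When the actions are contractive, the sum norm is submultiplicative and makes the amalgamated
  duplication a Banach algebra on the nose; in general it is one up to an equivalent norm.
\<close>

lemma banach_algebra_amalgamated_duplication:
  assumes "banach_bimodule A B l r" and "compatible_actions A l r"
    and l1: "\<And>\<beta> a. nrm A (l \<beta> a) \<le> nrm B \<beta> * nrm A a"
    and r1: "\<And>a \<beta>. nrm A (r a \<beta>) \<le> nrm A a * nrm B \<beta>"
  shows "banach_algebra (amalgamated_duplication A B l r)" (is "banach_algebra ?C")
proof -
  interpret banach_bimodule A B l r by fact
  note lins = linear_l_right linear_l_left linear_r_right linear_r_left
    A.linear_mul_left A.linear_mul_right B.linear_mul_left B.linear_mul_right
  have adds: "l \<beta> (a + a') = l \<beta> a + l \<beta> a'" "l (\<beta> + \<beta>') a = l \<beta> a + l \<beta>' a"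
    "r (a + a') \<beta> = r a \<beta> + r a' \<beta>" "r a (\<beta> + \<beta>') = r a \<beta> + r a \<beta>'"
    "mul A (a + a') b = mul A a b + mul A a' b" "mul A b (a + a') = mul A b a + mul A b a'"
    "mul B (\<beta> + \<beta>') \<gamma> = mul B \<beta> \<gamma> + mul B \<beta>' \<gamma>" "mul B \<gamma> (\<beta> + \<beta>') = mul B \<gamma> \<beta> + mul B \<gamma> \<beta>'"
    for a a' b \<beta> \<beta>' \<gamma>
    using lins by (auto simp: Vector_Spaces.linear_iff)
  have smuls: "l \<beta> (smul A c a) = smul A c (l \<beta> a)" "l (smul B c \<beta>) a = smul A c (l \<beta> a)"
    "r (smul A c a) \<beta> = smul A c (r a \<beta>)" "r a (smul B c \<beta>) = smul A c (r a \<beta>)"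
    "mul A (smul A c a) b = smul A c (mul A a b)" "mul A b (smul A c a) = smul A c (mul A b a)"
    "mul B (smul B c \<beta>) \<gamma> = smul B c (mul B \<beta> \<gamma>)" "mul B \<gamma> (smul B c \<beta>) = smul B c (mul B \<gamma> \<beta>)"
    for a b \<beta> \<gamma> c
    using lins by (auto simp: Vector_Spaces.linear_iff)
  have comp: "l \<beta> (mul A a b) = mul A (l \<beta> a) b" "r (mul A a b) \<beta> = mul A a (r b \<beta>)"
     "mul A a (l \<beta> b) = mul A (r a \<beta>) b" for a b \<beta>
    using assms(2) unfolding compatible_actions_def by blast+
  interpret VA: vector_space "smul A" by (rule A.vector_space)
  interpret VB: vector_space "smul B" by (rule B.vector_space)
  have vs: "vector_space (smul ?C)"
    by unfold_locales (auto simp: amalgamated_duplication_def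
       VA.scale_right_distrib VA.scale_left_distrib VB.scale_right_distrib VB.scale_left_distrib)
  let ?d = "\<lambda>x y. nrm ?C (x - y)"
  interpret MA: Metric_space UNIV "\<lambda>x y. nrm A (x - y)" by (rule A.Metric_space_nrm)
  interpret MB: Metric_space UNIV "\<lambda>x y. nrm B (x - y)" by (rule B.Metric_space_nrm)
  have nC: "nrm ?C x = nrm A (fst x) + nrm B (snd x)" for x
    by (simp add: amalgamated_duplication_def split_beta)
  interpret MC: Metric_space UNIV ?d
  proof
    fix x y z
    show "0 \<le> ?d x y" by (simp add: nC A.nrm_nonneg B.nrm_nonneg)
    show "?d x y = ?d y x" using MA.commute[of "fst x" "fst y"] MB.commute[of "snd x" "snd y"] by (simp add: nC)
    show "?d x y = 0 \<longleftrightarrow> x = y"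
      using A.nrm_nonneg[of "fst x - fst y"] B.nrm_nonneg[of "snd x - snd y"]
      by (auto simp: nC add_nonneg_eq_0_iff A.nrm_eq_0_iff B.nrm_eq_0_iff prod_eq_iff)
    show "?d x z \<le> ?d x y + ?d y z"
      using MA.triangle[of "fst x" "fst y" "fst z"] MB.triangle[of "snd x" "snd y" "snd z"] by (simp add: nC)
  qed
  have comp': "MC.mcomplete"
    unfolding MC.mcomplete_def
  proof (intro allI impI)
    fix s assume s: "MC.MCauchy s"
    have sA: "MA.MCauchy (fst \<circ> s)" unfolding MA.MCauchy_def
    proof (intro conjI allI impI)
      fix e :: real assume "e > 0"
      then obtain N where N: "\<And>m n. N \<le> m \<Longrightarrow> N \<le> n \<Longrightarrow> ?d (s m) (s n) < e" using s unfolding MC.MCauchy_def by meson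
      show "\<exists>N. \<forall>n n'. N \<le> n \<longrightarrow> N \<le> n' \<longrightarrow> nrm A ((fst \<circ> s) n - (fst \<circ> s) n') < e"
      proof (intro exI[of _ N] allI impI)
        fix n n' assume "N \<le> n" "N \<le> n'"
        then show "nrm A ((fst \<circ> s) n - (fst \<circ> s) n') < e"
          using N[of n n'] B.nrm_nonneg[of "snd (s n) - snd (s n')"]
          unfolding nC fst_diff snd_diff comp_apply by linarith
      qed
    qed simp
    have sB: "MB.MCauchy (snd \<circ> s)" unfolding MB.MCauchy_def
    proof (intro conjI allI impI)
      fix e :: real assume "e > 0"
      then obtain N where N: "\<And>m n. N \<le> m \<Longrightarrow> N \<le> n \<Longrightarrow> ?d (s m) (s n) < e" using s unfolding MC.MCauchy_def by meson
      show "\<exists>N. \<forall>n n'. N \<le> n \<longrightarrow> N \<le> n' \<longrightarrow> nrm B ((snd \<circ> s) n - (snd \<circ> s) n') < e"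
      proof (intro exI[of _ N] allI impI)
        fix n n' assume "N \<le> n" "N \<le> n'"
        then show "nrm B ((snd \<circ> s) n - (snd \<circ> s) n') < e"
          using N[of n n'] A.nrm_nonneg[of "fst (s n) - fst (s n')"]
          unfolding nC fst_diff snd_diff comp_apply by linarith
      qed
    qed simp
    obtain a where a: "limitin MA.mtopology (fst \<circ> s) a sequentially"
      using A.complete sA unfolding MA.mcomplete_def by blast
    obtain b where b: "limitin MB.mtopology (snd \<circ> s) b sequentially"
      using B.complete sB unfolding MB.mcomplete_def by blast
    have "limitin MC.mtopology s (a, b) sequentially"
      unfolding MC.limit_metric_sequentially
    proof (intro conjI allI impI)
      fix e :: real assume e: "e > 0"
      obtain N1 where N1: "\<And>n. n \<ge> N1 \<Longrightarrow> nrm A (fst (s n) - a) < e/2"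
        using a e unfolding MA.limit_metric_sequentially by (metis comp_apply half_gt_zero)
      obtain N2 where N2: "\<And>n. n \<ge> N2 \<Longrightarrow> nrm B (snd (s n) - b) < e/2"
        using b e unfolding MB.limit_metric_sequentially by (metis comp_apply half_gt_zero)
      show "\<exists>N. \<forall>n\<ge>N. s n \<in> UNIV \<and> ?d (s n) (a, b) < e"
      proof (intro exI[of _ "max N1 N2"] allI impI conjI)
        fix n assume "max N1 N2 \<le> n"
        then show "?d (s n) (a, b) < e" using N1[of n] N2[of n] by (simp add: nC)
      qed simp
    qed simp
    then show "\<exists>x. limitin MC.mtopology s x sequentially" by blast
  qed
  show ?thesis
  proof (rule banach_algebra.intro)
    fix x y z :: "'a \<times> 'b" and c
    show "vector_space (smul ?C)" by (rule vs)
    show "nrm ?C x = 0 \<longleftrightarrow> x = 0" using MC.zero[of x 0] by simp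
    show "nrm ?C (x + y) \<le> nrm ?C x + nrm ?C y"
      using A.nrm_triangle[of "fst x" "fst y"] B.nrm_triangle[of "snd x" "snd y"] by (simp add: nC)
    show "nrm ?C (smul ?C c x) = cmod c * nrm ?C x"
      by (simp add: amalgamated_duplication_def split_beta A.nrm_smul B.nrm_smul algebra_simps)
    show "MC.mcomplete" by (rule comp')
    show "Vector_Spaces.linear (smul ?C) (smul ?C) (\<lambda>y. mul ?C x y)"
      using vs by (auto simp: Vector_Spaces.linear_iff amalgamated_duplication_def split_beta adds smuls VA.scale_right_distrib)
    show "Vector_Spaces.linear (smul ?C) (smul ?C) (\<lambda>x. mul ?C x y)"
      using vs by (auto simp: Vector_Spaces.linear_iff amalgamated_duplication_def split_beta adds smuls VA.scale_right_distrib)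
    show "mul ?C (mul ?C x y) z = mul ?C x (mul ?C y z)"
      by (simp add: amalgamated_duplication_def split_beta adds comp A.mul_assoc B.mul_assoc l_mul r_mul l_r algebra_simps)
    show "nrm ?C (mul ?C x y) \<le> nrm ?C x * nrm ?C y"
    proof -
      obtain a \<beta> b \<gamma> where xy: "x = (a, \<beta>)" "y = (b, \<gamma>)" by (metis surj_pair)
      show ?thesis
        using A.nrm_triangle[of "mul A a b + r a \<gamma>" "l \<beta> b"] A.nrm_triangle[of "mul A a b" "r a \<gamma>"]
          A.nrm_mul[of a b] B.nrm_mul[of \<beta> \<gamma>] l1[of \<beta> b] r1[of a \<gamma>]
        by (simp add: xy amalgamated_duplication_def algebra_simps)
    qed
  qed
qed

text \<open>Continuity is not part of the definition of a character; it is automatic on a Banach algebra.\<close>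

definition characters :: "'c::ab_group_add normed_alg \<Rightarrow> ('c \<Rightarrow> complex) set" where
  "characters C = {\<phi>. Vector_Spaces.linear (smul C) (*) \<phi> \<and>
     (\<forall>x y. \<phi> (mul C x y) = \<phi> x * \<phi> y) \<and> \<phi> \<noteq> (\<lambda>_. 0)}"

definition pair_functional :: "('a \<Rightarrow> complex) \<Rightarrow> ('b \<Rightarrow> complex) \<Rightarrow> 'a \<times> 'b \<Rightarrow> complex" where
  "pair_functional \<phi> \<psi> = (\<lambda>(a, \<beta>). \<phi> a + \<psi> \<beta>)"

definition is_induced_functional ::
  "'b::ab_group_add normed_alg \<Rightarrow> ('b \<Rightarrow> 'a \<Rightarrow> 'a) \<Rightarrow> ('a \<Rightarrow> 'b \<Rightarrow> 'a) \<Rightarrow>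
    ('a \<Rightarrow> complex) \<Rightarrow> ('b \<Rightarrow> complex) \<Rightarrow> bool" where
  "is_induced_functional B l r \<phi> \<psi> \<longleftrightarrow>
    \<psi> \<in> characters B \<union> {\<lambda>_. 0} \<and>
    (\<forall>a \<beta>. \<phi> (r a \<beta>) = \<phi> a * \<psi> \<beta> \<and> \<phi> (l \<beta> a) = \<phi> a * \<psi> \<beta>)"

definition induced_functional ::
  "'b::ab_group_add normed_alg \<Rightarrow> ('b \<Rightarrow> 'a \<Rightarrow> 'a) \<Rightarrow> ('a \<Rightarrow> 'b \<Rightarrow> 'a) \<Rightarrow>
    ('a \<Rightarrow> complex) \<Rightarrow> ('b \<Rightarrow> complex)" where
  "induced_functional B l r \<phi> = (THE \<psi>. is_induced_functional B l r \<phi> \<psi>)"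

lemma ex1_induced_functional:
  assumes "banach_bimodule A B l r" and "compatible_actions A l r" and "\<phi> \<in> characters A"
  shows "\<exists>!\<psi>. is_induced_functional B l r \<phi> \<psi>"
proof -
  interpret banach_bimodule A B l r by fact
  have lin: "Vector_Spaces.linear (smul A) (*) \<phi>"
    and mult: "\<And>x y. \<phi> (mul A x y) = \<phi> x * \<phi> y" and nz: "\<phi> \<noteq> (\<lambda>_. 0)"
    using assms(3) by (auto simp: characters_def)
  obtain a0 where a0: "\<phi> a0 \<noteq> 0" using nz by auto
  define \<psi> where "\<psi> = (\<lambda>\<beta>. \<phi> (r a0 \<beta>) * inverse (\<phi> a0))"
  have mid: "\<phi> a * \<phi> (l \<beta> b) = \<phi> (r a \<beta>) * \<phi> b" for a b \<beta>
    using assms(2) mult unfolding compatible_actions_def by metis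
  have left: "\<phi> (l \<beta> b) = \<phi> b * \<psi> \<beta>" for b \<beta>
    using mid[of a0 \<beta> b] a0 by (simp add: \<psi>_def field_simps)
  have right: "\<phi> (r a \<beta>) = \<phi> a * \<psi> \<beta>" for a \<beta>
    using mid[of a \<beta> a0] a0 left[of \<beta> a0] by simp
  have \<psi>_lin: "Vector_Spaces.linear (smul B) (*) \<psi>"
  proof -
    interpret R: Vector_Spaces.linear "smul B" "smul A" "\<lambda>\<beta>. r a0 \<beta>" by (rule linear_r_right)
    interpret P: Vector_Spaces.linear "smul A" "(*)" \<phi> by (rule lin)
    show ?thesis
      by unfold_locales (simp_all add: \<psi>_def R.add P.add R.scale P.scale algebra_simps)
  qed
  have \<psi>_mult: "\<psi> (mul B \<beta> \<gamma>) = \<psi> \<beta> * \<psi> \<gamma>" for \<beta> \<gamma>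
    using right[of a0 "mul B \<beta> \<gamma>"] right[of "r a0 \<beta>" \<gamma>] right[of a0 \<beta>] a0
    by (simp add: r_mul)
  show ?thesis
  proof (rule ex1I[of _ \<psi>])
    show "is_induced_functional B l r \<phi> \<psi>"
      using \<psi>_lin \<psi>_mult left right by (auto simp: is_induced_functional_def characters_def)
  next
    fix \<psi>' assume "is_induced_functional B l r \<phi> \<psi>'"
    then have "\<phi> (r a0 \<beta>) = \<phi> a0 * \<psi>' \<beta>" for \<beta> by (auto simp: is_induced_functional_def)
    then show "\<psi>' = \<psi>" using a0 by (auto simp: \<psi>_def)
  qed
qed

end

theory Submission
  imports Defs
begin

text \<open>
  A linear functional on the product is a pair \<open>(\<phi>, \<psi>)\<close> of linear functionals, and multiplicativity
  of the pair can be tested on the four kinds of products of elements \<open>(a, 0)\<close> and \<open>(0, \<beta>)\<close>. These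
  products are \<open>(a b, 0)\<close>, \<open>(0, \<beta> \<gamma>)\<close>, \<open>(a \<cdot> \<gamma>, 0)\<close> and \<open>(\<beta> \<cdot> b, 0)\<close>, so the pair is multiplicative
  if and only if \<open>\<phi>\<close> and \<open>\<psi>\<close> are multiplicative and \<open>\<phi> (a \<cdot> \<gamma>) = \<phi> a * \<psi> \<gamma>\<close>,
  \<open>\<phi> (\<beta> \<cdot> b) = \<phi> b * \<psi> \<beta>\<close>. The last two equations say that \<open>\<psi>\<close> is the functional induced by \<open>\<phi>\<close>
  when \<open>\<phi>\<close> is non-zero (by uniqueness of the latter), and say nothing when \<open>\<phi> = 0\<close>. The first case
  gives \<open>E\<close>, the second \<open>F\<close>, and the two are told apart by whether the functional vanishes on the
  elements \<open>(a, 0)\<close>.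
\<close>

text \<open>
  Allowing the zero functional makes the set of characters purely equational, so that the
  characterisation of pairs below needs no case distinction.
\<close>

lemma characters_or_zero_iff:
  assumes "vector_space (smul C)"
  shows "\<phi> \<in> characters C \<union> {\<lambda>_. 0} \<longleftrightarrow>
    (\<forall>x y. \<phi> (x + y) = \<phi> x + \<phi> y) \<and> (\<forall>c x. \<phi> (smul C c x) = c * \<phi> x) \<and>
    (\<forall>x y. \<phi> (mul C x y) = \<phi> x * \<phi> y)"
proof -
  have "vector_space ((*) :: complex \<Rightarrow> complex \<Rightarrow> complex)"
    by unfold_locales (simp_all add: algebra_simps)
  then show ?thesis
    using assms by (auto simp: characters_def Vector_Spaces.linear_iff)
qed

lemma characters_or_zero_at_0:
  fixes \<phi> :: "'c::ab_group_add \<Rightarrow> complex"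
  assumes "\<phi> \<in> characters C \<union> {\<lambda>_. 0}"
  shows "\<phi> 0 = 0"
proof (cases "\<phi> = (\<lambda>_. 0)")
  case False
  then interpret Vector_Spaces.linear "smul C" "(*)" \<phi>
    using assms by (auto simp: characters_def)
  show ?thesis by (rule zero)
qed simp

lemma pair_functional_components:
  assumes "\<phi> 0 = 0" and "\<psi> 0 = 0"
  shows "pair_functional \<phi> \<psi> (a, 0) = \<phi> a" and "pair_functional \<phi> \<psi> (0, \<beta>) = \<psi> \<beta>"
  using assms by (simp_all add: pair_functional_def)

lemma pair_functional_eq_iff:
  assumes "\<phi> 0 = 0" "\<psi> 0 = 0" "\<phi>' 0 = 0" "\<psi>' 0 = 0"
  shows "pair_functional \<phi> \<psi> = pair_functional \<phi>' \<psi>' \<longleftrightarrow> \<phi> = \<phi>' \<and> \<psi> = \<psi>'"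
  using pair_functional_components[of \<phi> \<psi>] pair_functional_components[of \<phi>' \<psi>'] assms
  by (metis ext)

lemma additive_functional_eq_pair_functional:
  fixes \<Theta> :: "'a::ab_group_add \<times> 'b::ab_group_add \<Rightarrow> complex"
  assumes "\<And>x y. \<Theta> (x + y) = \<Theta> x + \<Theta> y"
  shows "\<Theta> = pair_functional (\<lambda>a. \<Theta> (a, 0)) (\<lambda>\<beta>. \<Theta> (0, \<beta>))"
proof
  fix x :: "'a \<times> 'b"
  show "\<Theta> x = pair_functional (\<lambda>a. \<Theta> (a, 0)) (\<lambda>\<beta>. \<Theta> (0, \<beta>)) x"
    using assms[of "(fst x, 0)" "(0, snd x)"] by (simp add: pair_functional_def split_beta)
qed

context banach_bimodule
begin

lemma vector_space_amalgamated_duplication: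
  "vector_space (smul (amalgamated_duplication A B l r))"
proof -
  interpret VA: vector_space "smul A" by (rule A.vector_space)
  interpret VB: vector_space "smul B" by (rule B.vector_space)
  show ?thesis
    by unfold_locales (auto simp: amalgamated_duplication_def
       VA.scale_right_distrib VA.scale_left_distrib VB.scale_right_distrib VB.scale_left_distrib)
qed

lemma bimodule_zero:
  "l \<beta> 0 = 0" "l 0 a = 0" "r a 0 = 0" "r 0 \<beta> = 0"
  "mul A a 0 = 0" "mul A 0 a = 0" "mul B \<beta> 0 = 0" "mul B 0 \<beta> = 0"
proof -
  note zero = Vector_Spaces.linear.axioms(3)[THEN module_hom.zero]
  show "l \<beta> 0 = 0" "l 0 a = 0" "r a 0 = 0" "r 0 \<beta> = 0"
    by (rule zero[OF linear_l_right] zero[OF linear_l_left]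
        zero[OF linear_r_right] zero[OF linear_r_left])+
  show "mul A a 0 = 0" "mul A 0 a = 0" "mul B \<beta> 0 = 0" "mul B 0 \<beta> = 0"
    by (rule zero[OF A.linear_mul_right] zero[OF A.linear_mul_left]
        zero[OF B.linear_mul_right] zero[OF B.linear_mul_left])+
qed

text \<open>
  The heart of the matter: the four kinds of products of elements \<open>(a, 0)\<close> and \<open>(0, \<beta>)\<close> give exactly
  multiplicativity of both components and the two identities defining an induced functional.
\<close>

lemma pair_functional_characters_or_zero_iff:
  assumes "\<phi> 0 = 0" and "\<psi> 0 = 0"
  shows "pair_functional \<phi> \<psi> \<in> characters (amalgamated_duplication A B l r) \<union> {\<lambda>_. 0} \<longleftrightarrow>
    \<phi> \<in> characters A \<union> {\<lambda>_. 0} \<and> is_induced_functional B l r \<phi> \<psi>"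
    (is "?P \<in> characters ?D \<union> _ \<longleftrightarrow> _")
proof
  assume "?P \<in> characters ?D \<union> {\<lambda>_. 0}"
  then have add: "?P (x + y) = ?P x + ?P y" and smul: "?P (smul ?D c x) = c * ?P x"
    and mul: "?P (mul ?D x y) = ?P x * ?P y" for x y c
    unfolding characters_or_zero_iff[OF vector_space_amalgamated_duplication] by blast+
  note simps = amalgamated_duplication_def pair_functional_def assms bimodule_zero
    A.smul_zero B.smul_zero
  have \<phi>: "\<phi> (a + b) = \<phi> a + \<phi> b" "\<phi> (smul A c a) = c * \<phi> a" "\<phi> (mul A a b) = \<phi> a * \<phi> b" for a b c
    using add[of "(a, 0)" "(b, 0)"] smul[of c "(a, 0)"] mul[of "(a, 0)" "(b, 0)"]
    by (simp_all add: simps)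
  have \<psi>: "\<psi> (\<beta> + \<gamma>) = \<psi> \<beta> + \<psi> \<gamma>" "\<psi> (smul B c \<beta>) = c * \<psi> \<beta>" "\<psi> (mul B \<beta> \<gamma>) = \<psi> \<beta> * \<psi> \<gamma>"
    for \<beta> \<gamma> c
    using add[of "(0, \<beta>)" "(0, \<gamma>)"] smul[of c "(0, \<beta>)"] mul[of "(0, \<beta>)" "(0, \<gamma>)"]
    by (simp_all add: simps)
  have "\<phi> (r a \<beta>) = \<phi> a * \<psi> \<beta>" "\<phi> (l \<beta> a) = \<phi> a * \<psi> \<beta>" for a \<beta>
    using mul[of "(a, 0)" "(0, \<beta>)"] mul[of "(0, \<beta>)" "(a, 0)"] by (simp_all add: simps)
  then show "\<phi> \<in> characters A \<union> {\<lambda>_. 0} \<and> is_induced_functional B l r \<phi> \<psi>"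
    unfolding is_induced_functional_def characters_or_zero_iff[OF A.vector_space]
      characters_or_zero_iff[OF B.vector_space]
    using \<phi> \<psi> by blast
next
  assume *: "\<phi> \<in> characters A \<union> {\<lambda>_. 0} \<and> is_induced_functional B l r \<phi> \<psi>"
  then have "\<phi> (a + b) = \<phi> a + \<phi> b" "\<phi> (smul A c a) = c * \<phi> a" "\<phi> (mul A a b) = \<phi> a * \<phi> b" for a b c
    unfolding characters_or_zero_iff[OF A.vector_space] by blast+
  moreover have "\<psi> (\<beta> + \<gamma>) = \<psi> \<beta> + \<psi> \<gamma>" "\<psi> (smul B c \<beta>) = c * \<psi> \<beta>"
    "\<psi> (mul B \<beta> \<gamma>) = \<psi> \<beta> * \<psi> \<gamma>" "\<phi> (r a \<beta>) = \<phi> a * \<psi> \<beta>" "\<phi> (l \<beta> a) = \<phi> a * \<psi> \<beta>" for a \<beta> \<gamma> c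
    using * unfolding is_induced_functional_def characters_or_zero_iff[OF B.vector_space] by blast+
  ultimately show "?P \<in> characters ?D \<union> {\<lambda>_. 0}"
    unfolding characters_or_zero_iff[OF vector_space_amalgamated_duplication]
    by (simp add: amalgamated_duplication_def pair_functional_def split_beta algebra_simps)
qed

lemma characters_amalgamated_duplication:
  "characters (amalgamated_duplication A B l r) =
    {pair_functional \<phi> \<psi> | \<phi> \<psi>. \<phi> \<in> characters A \<and> is_induced_functional B l r \<phi> \<psi>} \<union>
    {pair_functional (\<lambda>_. 0) \<psi> | \<psi>. \<psi> \<in> characters B}"
    (is "characters ?D = ?E \<union> ?F")
proof
  show "characters ?D \<subseteq> ?E \<union> ?F"
  proof
    fix \<Theta> assume \<Theta>: "\<Theta> \<in> characters ?D"
    define \<phi> where "\<phi> = (\<lambda>a. \<Theta> (a, 0))"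
    define \<psi> where "\<psi> = (\<lambda>\<beta>. \<Theta> (0, \<beta>))"
    have zero: "\<phi> 0 = 0" "\<psi> 0 = 0"
      using characters_or_zero_at_0[of \<Theta> ?D] \<Theta> by (simp_all add: \<phi>_def \<psi>_def zero_prod_def)
    have eq: "\<Theta> = pair_functional \<phi> \<psi>"
      unfolding \<phi>_def \<psi>_def
      using \<Theta> characters_or_zero_iff[OF vector_space_amalgamated_duplication, of \<Theta>]
      by (intro additive_functional_eq_pair_functional) blast
    have *: "\<phi> \<in> characters A \<union> {\<lambda>_. 0}" "is_induced_functional B l r \<phi> \<psi>"
      using \<Theta> pair_functional_characters_or_zero_iff[of \<phi> \<psi>, OF zero] unfolding eq by blast+
    show "\<Theta> \<in> ?E \<union> ?F"
    proof (cases "\<phi> = (\<lambda>_. 0)")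
      case True
      have "\<psi> \<noteq> (\<lambda>_. 0)"
        using \<Theta> unfolding eq True by (auto simp: characters_def pair_functional_def)
      then have "\<psi> \<in> characters B" using *(2) unfolding is_induced_functional_def by blast
      then show ?thesis unfolding eq True by blast
    next
      case False
      then show ?thesis using * eq by blast
    qed
  qed
next
  have "pair_functional \<phi> \<psi> \<in> characters ?D"
    if "\<phi> \<in> characters A \<union> {\<lambda>_. 0}" "is_induced_functional B l r \<phi> \<psi>"
      and nz: "\<phi> \<noteq> (\<lambda>_. 0) \<or> \<psi> \<noteq> (\<lambda>_. 0)" for \<phi> \<psi>
  proof -
    have zero: "\<phi> 0 = 0" "\<psi> 0 = 0"
      using that characters_or_zero_at_0 unfolding is_induced_functional_def by blast+
    have "pair_functional \<phi> \<psi> \<noteq> (\<lambda>_. 0)"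
      using pair_functional_components[of \<phi> \<psi>, OF zero] nz by (metis ext)
    then show ?thesis using pair_functional_characters_or_zero_iff[of \<phi> \<psi>, OF zero] that by blast
  qed
  note pair = this
  have "?E \<subseteq> characters ?D"
    using pair by (auto simp: characters_def[of A])
  moreover have "pair_functional (\<lambda>_. 0) \<psi> \<in> characters ?D" if "\<psi> \<in> characters B" for \<psi>
    using that by (intro pair) (auto simp: is_induced_functional_def characters_def)
  ultimately show "?E \<union> ?F \<subseteq> characters ?D" by blast
qed

end

theorem proposition3p8:
  fixes A :: "'a::ab_group_add normed_alg" and B :: "'b::ab_group_add normed_alg"
    and l :: "'b \<Rightarrow> 'a \<Rightarrow> 'a" and r :: "'a \<Rightarrow> 'b \<Rightarrow> 'a"
    and E F :: "('a \<times> 'b \<Rightarrow> complex) set"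
  assumes "banach_algebra A" and "banach_algebra B"
    and "banach_bimodule A B l r" and "compatible_actions A l r"
  defines "E \<equiv> {pair_functional \<phi> (induced_functional B l r \<phi>) | \<phi>. \<phi> \<in> characters A}"
    and "F \<equiv> {pair_functional (\<lambda>_. 0) \<psi> | \<psi>. \<psi> \<in> characters B}"
  shows "E \<inter> F = {} \<and> characters (amalgamated_duplication A B l r) = E \<union> F"
proof
  interpret banach_bimodule A B l r by fact
  have induced_iff: "is_induced_functional B l r \<phi> \<psi> \<longleftrightarrow> \<psi> = induced_functional B l r \<phi>"
    if "\<phi> \<in> characters A" for \<phi> \<psi>
    unfolding induced_functional_def
    using ex1_induced_functional[OF assms(3,4) that] by (metis theI')
  show "E \<inter> F = {}"
  proof -
    have "pair_functional \<phi> (induced_functional B l r \<phi>) \<noteq> pair_functional (\<lambda>_. 0) \<psi>"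
      if "\<phi> \<in> characters A" "\<psi> \<in> characters B" for \<phi> \<psi>
    proof -
      have "induced_functional B l r \<phi> \<in> characters B \<union> {\<lambda>_. 0}"
        using induced_iff[OF that(1)] unfolding is_induced_functional_def by blast
      then have "induced_functional B l r \<phi> 0 = 0" by (rule characters_or_zero_at_0)
      moreover have "\<phi> 0 = 0" "\<psi> 0 = 0" using that characters_or_zero_at_0 by blast+
      moreover have "\<phi> \<noteq> (\<lambda>_. 0)" using that(1) by (simp add: characters_def)
      ultimately show ?thesis by (simp add: pair_functional_eq_iff)
    qed
    then show ?thesis unfolding E_def F_def by blast
  qed
  have "E = {pair_functional \<phi> \<psi> | \<phi> \<psi>. \<phi> \<in> characters A \<and> is_induced_functional B l r \<phi> \<psi>}"
    unfolding E_def using induced_iff by (auto intro!: Collect_cong)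
  then show "characters (amalgamated_duplication A B l r) = E \<union> F"
    unfolding F_def characters_amalgamated_duplication by simp
qed

end
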